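(* Let $(S,\circ)$ be a right loop with identity $e$. Suppose that $G_S$ acts transitively on $S\setminus\{e\}$ and that, for some $y\in S\setminus\{e\}$, the map $\sigma_y:G_S\to G_S$ defined by $\sigma_y(h)(x)\circ h(y)=h(x\circ y)$ ($x\in S$, $h\in G_S$) is a homomorphism. Then $\sigma_x=\sigma_y$ for each $x\in S\setminus\{e\}$. If in addition $f(x',x)=I_S$ for all $x\in S$, where $x'$ denotes the left inverse of $x$, then $\sigma_y$ is an involutory automorphism of $G_S$, and moreover $G_S\subseteq TAut(S,\circ)$.
   Context: A right loop $(S,\circ)$ with identity $e$ is a set $S$ with a binary operation $\circ$ and a two-sided identity $e$ such that for all $a,b\in S$ the equation $x\circ a=b$ has a unique solution $x\in S$. The left inverse $x'$ of $x$ is the unique element with $x'\circ x=e$. For $y,z\in S$ the right inner mapping $f(y,z):S\to S$ is the bijection defined by $f(y,z)(x)\circ(y\circ z)=(x\circ y)\circ z$ for all $x\in S$; it fixes $e$. The inner mapping group $G_S$ is the subgroup of $Sym(S\setminus\{e\})\subseteq Sym(S)$ (permutations of $S$ fixing $e$) generated by $\{f(y,z): y,z\in S\}$. Products of maps are composed left to right: $(gf)(x)=f(g(x))$. For $y\in S$ and $h\in G_S$, the permutation $\sigma_y(h)$ of $S$ is determined by $\sigma_y(h)(x)\circ h(y)=h(x\circ y)$ for all $x\in S$; it lies in $G_S$. $I_S$ is the identity map. An automorphism $\eta$ is involutory if $\eta^2$ is the identity ($\eta$ equal to the identity is allowed). If $f(x',x)=I_S$ for all $x$, then $x'$ is the unique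 two-sided inverse of $x$. In a right loop with unique two-sided inverses $x'$, a twisted automorphism is a bijective map $h:S\to S$ such that $h(x\circ y)=[h(x')]'\circ h(y)$ for all $x,y\in S$ with $y\neq e$; $TAut(S,\circ)$ is the set of all twisted automorphisms. *)

theory Defs
  imports "HOL-Algebra.Bij" "HOL-Algebra.Elementary_Groups"
begin

locale right_loop =
  fixes S (structure)
  assumes m_closed: "\<lbrakk>x \<in> carrier S; y \<in> carrier S\<rbrakk> \<Longrightarrow> x \<otimes> y \<in> carrier S"
    and one_closed: "\<one> \<in> carrier S"
    and l_one: "x \<in> carrier S \<Longrightarrow> \<one> \<otimes> x = x"
    and r_one: "x \<in> carrier S \<Longrightarrow> x \<otimes> \<one> = x"
    and right_div: "\<lbrakk>a \<in> carrier S; b \<in> carrier S\<rbrakk> \<Longrightarrow> \<exists>!x. x \<in> carrier S \<and> x \<otimes> a = b"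

definition left_inv :: "('a, 'b) monoid_scheme \<Rightarrow> 'a \<Rightarrow> 'a"
  where "left_inv S x = (THE y. y \<in> carrier S \<and> y \<otimes>\<^bsub>S\<^esub> x = \<one>\<^bsub>S\<^esub>)"

definition right_inner :: "('a, 'b) monoid_scheme \<Rightarrow> 'a \<Rightarrow> 'a \<Rightarrow> 'a \<Rightarrow> 'a"
  where "right_inner S y z =
    (\<lambda>x\<in>carrier S. THE w. w \<in> carrier S \<and> w \<otimes>\<^bsub>S\<^esub> (y \<otimes>\<^bsub>S\<^esub> z) = (x \<otimes>\<^bsub>S\<^esub> y) \<otimes>\<^bsub>S\<^esub> z)"

text \<open>
  The group \<open>Sym (S - {e})\<close>, realised as the permutations of \<open>S\<close> fixing the identity \<open>e\<close>.
  Maps are composed from left to right, so the multiplication is opposite to that of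
  \<^const>\<open>BijGroup\<close>. As there, permutations are extensional functions (members of \<^const>\<open>Bij\<close>).
\<close>

definition sym_fix :: "('a, 'b) monoid_scheme \<Rightarrow> ('a \<Rightarrow> 'a) monoid"
  where "sym_fix S =
    \<lparr>carrier = {h \<in> Bij (carrier S). h \<one>\<^bsub>S\<^esub> = \<one>\<^bsub>S\<^esub>},
     mult = (\<lambda>g h. compose (carrier S) h g),
     one = (\<lambda>x\<in>carrier S. x)\<rparr>"

definition inner_mapping_group :: "('a, 'b) monoid_scheme \<Rightarrow> ('a \<Rightarrow> 'a) monoid"
  where "inner_mapping_group S =
    subgroup_generated (sym_fix S) {right_inner S y z | y z. y \<in> carrier S \<and> z \<in> carrier S}"

definition sigma :: "('a, 'b) monoid_scheme \<Rightarrow> 'a \<Rightarrow> ('a \<Rightarrow> 'a) \<Rightarrow> 'a \<Rightarrow> 'a"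
  where "sigma S y =
    (\<lambda>h\<in>carrier (inner_mapping_group S). \<lambda>x\<in>carrier S.
       THE w. w \<in> carrier S \<and> w \<otimes>\<^bsub>S\<^esub> h y = h (x \<otimes>\<^bsub>S\<^esub> y))"

text \<open>
  Meaningful for right loops with unique two-sided inverses, which is what \<^const>\<open>m_inv\<close> denotes.
\<close>

definition TAut :: "('a, 'b) monoid_scheme \<Rightarrow> ('a \<Rightarrow> 'a) set"
  where "TAut S =
    {h \<in> Bij (carrier S). \<forall>x\<in>carrier S. \<forall>y\<in>carrier S. y \<noteq> \<one>\<^bsub>S\<^esub> \<longrightarrow>
       h (x \<otimes>\<^bsub>S\<^esub> y) = inv\<^bsub>S\<^esub> (h (inv\<^bsub>S\<^esub> x)) \<otimes>\<^bsub>S\<^esub> h y}"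

definition involutory_auto :: "('a, 'b) monoid_scheme \<Rightarrow> ('a \<Rightarrow> 'a) \<Rightarrow> bool"
  where "involutory_auto G \<eta> \<longleftrightarrow>
    \<eta> \<in> auto G \<and> compose (carrier G) \<eta> \<eta> = (\<lambda>g\<in>carrier G. g)"

context right_loop
begin

lemma right_div_THE:
  assumes "a \<in> carrier S" "b \<in> carrier S"
  shows "(THE x. x \<in> carrier S \<and> x \<otimes> a = b) \<in> carrier S"
    and "(THE x. x \<in> carrier S \<and> x \<otimes> a = b) \<otimes> a = b"
  using theI'[OF right_div[OF assms]] by auto

lemma right_cancel:
  "\<lbrakk>x \<in> carrier S; y \<in> carrier S; a \<in> carrier S; x \<otimes> a = y \<otimes> a\<rbrakk> \<Longrightarrow> x = y"
  using right_div[of a "y \<otimes> a"] m_closed by blast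

lemma group_sym_fix: "group (sym_fix S)"
proof (rule groupI)
  fix g assume g: "g \<in> carrier (sym_fix S)"
  let ?k = "\<lambda>x\<in>carrier S. inv_into (carrier S) g x"
  have b: "bij_betw g (carrier S) (carrier S)" "g \<one> = \<one>"
    using g by (auto simp: sym_fix_def Bij_def)
  have "?k \<in> Bij (carrier S)"
    using g by (simp add: sym_fix_def restrict_inv_into_Bij)
  moreover have "?k \<one> = \<one>"
    using b one_closed by (metis bij_betw_def inv_into_f_f restrict_apply')
  moreover have "compose (carrier S) g ?k = (\<lambda>x\<in>carrier S. x)"
    using b by (auto simp: compose_def restrict_def bij_betw_inv_into_right)
  ultimately show "\<exists>k\<in>carrier (sym_fix S). k \<otimes>\<^bsub>sym_fix S\<^esub> g = \<one>\<^bsub>sym_fix S\<^esub>"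
    by (intro bexI[of _ ?k]) (auto simp: sym_fix_def)
qed (auto simp: sym_fix_def compose_Bij id_Bij one_closed Bij_imp_funcset Bij_imp_extensional
       compose_Id[OF Bij_imp_funcset Bij_imp_extensional] compose_eq compose_assoc[OF Bij_imp_funcset])

text \<open>
  By the next lemma, intersecting the generators with the carrier in \<^const>\<open>subgroup_generated\<close> loses nothing.
\<close>

lemma right_inner_in_sym_fix:
  assumes y: "y \<in> carrier S" and z: "z \<in> carrier S"
  shows "right_inner S y z \<in> carrier (sym_fix S)"
proof -
  let ?f = "right_inner S y z"
  have f: "?f x \<in> carrier S" "?f x \<otimes> (y \<otimes> z) = (x \<otimes> y) \<otimes> z" if "x \<in> carrier S" for x
    using that y z m_closed right_div_THE[of "y \<otimes> z" "(x \<otimes> y) \<otimes> z"]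
    by (auto simp: right_inner_def)
  have "inj_on ?f (carrier S)"
    by (rule inj_onI) (metis f(2) m_closed right_cancel y z)
  moreover have "b \<in> ?f ` carrier S" if b: "b \<in> carrier S" for b
  proof -
    obtain u where u: "u \<in> carrier S" "u \<otimes> z = b \<otimes> (y \<otimes> z)"
      using right_div m_closed b y z by metis
    obtain x where x: "x \<in> carrier S" "x \<otimes> y = u"
      using right_div u y by metis
    have "?f x = b"
      using f[OF x(1)] u x b y z m_closed right_cancel by metis
    then show ?thesis using x by blast
  qed
  ultimately have "bij_betw ?f (carrier S) (carrier S)"
    using f(1) by (auto simp: bij_betw_def)
  moreover have "?f \<one> = \<one>"
    using f[OF one_closed] y z m_closed one_closed l_one right_cancel by metis
  ultimately show ?thesis
    by (auto simp: sym_fix_def Bij_def right_inner_def)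
qed

lemma inv_eq_left_inv:
  assumes f: "\<And>x. x \<in> carrier S \<Longrightarrow> right_inner S (left_inv S x) x = (\<lambda>z\<in>carrier S. z)"
    and x: "x \<in> carrier S"
  shows "inv x = left_inv S x" and "x \<otimes> left_inv S x = \<one>"
proof -
  have l: "left_inv S a \<in> carrier S" "left_inv S a \<otimes> a = \<one>" if "a \<in> carrier S" for a
    using right_div_THE[OF that one_closed] by (simp_all add: left_inv_def)
  let ?x' = "left_inv S x"
  have "right_inner S ?x' x x \<otimes> (?x' \<otimes> x) = (x \<otimes> ?x') \<otimes> x"
    using right_div_THE(2)[of "?x' \<otimes> x" "(x \<otimes> ?x') \<otimes> x"] l[OF x] x m_closed one_closed
    by (simp add: right_inner_def)
  then have "\<one> \<otimes> x = (x \<otimes> ?x') \<otimes> x"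
    using f[OF x] l[OF x] x l_one r_one by simp
  then show r: "x \<otimes> ?x' = \<one>"
    using right_cancel[of \<one> "x \<otimes> ?x'" x] x l[OF x] m_closed one_closed by simp
  show "inv x = ?x'"
    unfolding m_inv_def using l[OF x] r x right_cancel by (intro the_equality) metis+
qed

end

end

theory Submission
  imports Defs
begin

text \<open>
  Everything rests on the cocycle identity \<open>\<sigma>\<^sub>y(g h) = \<sigma>\<^sub>y(g) \<sigma>\<^bsub>g(y)\<^esub>(h)\<close>, which comes from
  expanding \<open>h(g(x \<circ> y))\<close> in two ways (products are composed from left to right). If \<open>\<sigma>\<^sub>y\<close> is a
  homomorphism, comparing with \<open>\<sigma>\<^sub>y(g h) = \<sigma>\<^sub>y(g) \<sigma>\<^sub>y(h)\<close> and cancelling the permutation \<open>\<sigma>\<^sub>y(g)\<close>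
  gives \<open>\<sigma>\<^bsub>g(y)\<^esub>(h) = \<sigma>\<^sub>y(h)\<close>, and by transitivity \<open>g(y)\<close> ranges over all of \<open>S - {e}\<close>. So there is
  a single map \<open>\<sigma>\<close> with \<open>\<sigma>(h)(x) \<circ> h(u) = h(x \<circ> u)\<close> for all \<open>x\<close> and all \<open>u \<noteq> e\<close>.

  Suppose moreover that \<open>f(u',u)\<close> is the identity, that is, \<open>(z \<circ> u') \<circ> u = z\<close>. Putting \<open>x = u'\<close> in
  the identity for \<open>\<sigma>\<close> gives \<open>\<sigma>(h)(u') \<circ> h(u) = e\<close>, so \<open>\<sigma>(h)(u') = h(u)'\<close>. Since \<open>u'' = u\<close>, this reads
  \<open>\<sigma>(h)(x) = h(x')'\<close> (for \<open>x = e\<close> both sides are \<open>e\<close>), and substituting it into the identity for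
  \<open>\<sigma>\<close> yields the twisted automorphism law for \<open>h\<close>. Finally, for \<open>u \<noteq> e\<close>,
  \<open>h(x) = h((x \<circ> u') \<circ> u) = \<sigma>(h)(x \<circ> u') \<circ> h(u) = (\<sigma>(\<sigma>(h))(x) \<circ> h(u)') \<circ> h(u) = \<sigma>(\<sigma>(h))(x)\<close>,
  so \<open>\<sigma>\<close> is an involution and hence an automorphism.
\<close>

context right_loop
begin

lemma inner_mapping_group_mult:
  "g \<otimes>\<^bsub>inner_mapping_group S\<^esub> h = compose (carrier S) h g"
  by (simp add: inner_mapping_group_def sym_fix_def)

lemma inner_mapping_group_memD:
  assumes "h \<in> carrier (inner_mapping_group S)"
  shows "h \<in> Bij (carrier S)" "h \<one> = \<one>"
proof -
  have "h \<in> carrier (sym_fix S)"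
    using assms group.carrier_subgroup_generated_subset[OF group_sym_fix]
    unfolding inner_mapping_group_def by blast
  then show "h \<in> Bij (carrier S)" "h \<one> = \<one>" by (auto simp: sym_fix_def)
qed

lemma inner_mapping_closed:
  "\<lbrakk>h \<in> carrier (inner_mapping_group S); x \<in> carrier S\<rbrakk> \<Longrightarrow> h x \<in> carrier S"
  using inner_mapping_group_memD(1) Bij_imp_funcset by blast

lemma inner_mapping_mult_closed:
  assumes "g \<in> carrier (inner_mapping_group S)" "h \<in> carrier (inner_mapping_group S)"
  shows "compose (carrier S) h g \<in> carrier (inner_mapping_group S)"
proof -
  have "group (inner_mapping_group S)"
    unfolding inner_mapping_group_def by (rule group.group_subgroup_generated[OF group_sym_fix])
  then have "g \<otimes>\<^bsub>inner_mapping_group S\<^esub> h \<in> carrier (inner_mapping_group S)"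
    using assms by (simp add: group.is_monoid monoid.m_closed)
  then show ?thesis by (simp add: inner_mapping_group_mult)
qed

lemma sigma_closed_and_eq:
  assumes "h \<in> carrier (inner_mapping_group S)" "x \<in> carrier S" "y \<in> carrier S"
  shows "sigma S y h x \<in> carrier S"
    and "sigma S y h x \<otimes> h y = h (x \<otimes> y)"
  using right_div_THE[of "h y" "h (x \<otimes> y)"] assms inner_mapping_closed m_closed
  by (simp_all add: sigma_def)

lemma sigma_eqI:
  assumes "h \<in> carrier (inner_mapping_group S)" "x \<in> carrier S" "y \<in> carrier S"
    and "w \<in> carrier S" "w \<otimes> h y = h (x \<otimes> y)"
  shows "sigma S y h x = w"
  using assms sigma_closed_and_eq[OF assms(1-3)] inner_mapping_closed right_cancel by metis

lemma sigma_extensional: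
  "h \<in> carrier (inner_mapping_group S) \<Longrightarrow> sigma S y h \<in> extensional (carrier S)"
  by (simp add: sigma_def)

text \<open>
  Both sides solve the equation \<open>w \<circ> h(g(y)) = h(g(x \<circ> y))\<close>.
\<close>

lemma sigma_cocycle:
  assumes g: "g \<in> carrier (inner_mapping_group S)" and h: "h \<in> carrier (inner_mapping_group S)"
    and x: "x \<in> carrier S" and y: "y \<in> carrier S"
  shows "sigma S y (compose (carrier S) h g) x = sigma S (g y) h (sigma S y g x)"
proof (rule sigma_eqI[OF inner_mapping_mult_closed[OF g h] x y])
  have gy: "g y \<in> carrier S" using g y by (rule inner_mapping_closed)
  note sg = sigma_closed_and_eq[OF g x y]
  note sh = sigma_closed_and_eq[OF h sg(1) gy]
  show "sigma S (g y) h (sigma S y g x) \<in> carrier S" by (fact sh(1))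
  show "sigma S (g y) h (sigma S y g x) \<otimes> compose (carrier S) h g y
      = compose (carrier S) h g (x \<otimes> y)"
    using sh(2) sg(2) x y m_closed by (simp add: compose_eq)
qed

text \<open>
  The homomorphism property turns the cocycle identity into an equality of \<open>\<sigma>\<^bsub>g(y)\<^esub>(h)\<close> and \<open>\<sigma>\<^sub>y(h)\<close>
  on the range of \<open>\<sigma>\<^sub>y(g)\<close>, which is all of \<open>S\<close>.
\<close>

lemma sigma_eq_on_orbit:
  assumes hom: "sigma S y \<in> hom (inner_mapping_group S) (inner_mapping_group S)"
    and y: "y \<in> carrier S" and g: "g \<in> carrier (inner_mapping_group S)"
  shows "sigma S (g y) = sigma S y"
proof (rule extensionalityI[where A = "carrier (inner_mapping_group S)"])
  fix h assume h: "h \<in> carrier (inner_mapping_group S)"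
  have "sigma S y g \<in> Bij (carrier S)"
    using hom g by (intro inner_mapping_group_memD(1)) (auto simp: hom_def)
  then have surj: "sigma S y g ` carrier S = carrier S"
    by (simp add: Bij_def bij_betw_def)
  have mult: "sigma S y (compose (carrier S) h g)
      = compose (carrier S) (sigma S y h) (sigma S y g)"
    using hom g h by (simp add: hom_def inner_mapping_group_mult)
  show "sigma S (g y) h = sigma S y h"
  proof (rule extensionalityI[where A = "carrier S"])
    fix z assume "z \<in> carrier S"
    then obtain x where x: "x \<in> carrier S" "z = sigma S y g x"
      using surj by blast
    show "sigma S (g y) h z = sigma S y h z"
      using sigma_cocycle[OF g h x(1) y] mult x by (simp add: compose_eq)
  qed (use h sigma_extensional in auto)
qed (simp_all add: sigma_def)

text \<open>
  Since \<open>x' \<circ> x = e\<close>, the defining equation of \<open>f(x',x)\<close> reduces to \<open>f(x',x)(z) = (z \<circ> x') \<circ> x\<close>; the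
  condition thus says that right multiplication by \<open>x'\<close> is undone by right multiplication by \<open>x\<close>.
\<close>

lemma right_inner_id_imp_cancel:
  assumes f: "\<forall>x\<in>carrier S. right_inner S (left_inv S x) x = (\<lambda>z\<in>carrier S. z)"
    and x: "x \<in> carrier S"
  shows "inv x \<in> carrier S" "inv x \<otimes> x = \<one>" "inv (inv x) = x"
    and "z \<in> carrier S \<Longrightarrow> (z \<otimes> inv x) \<otimes> x = z"
proof -
  have l: "left_inv S x \<in> carrier S" "left_inv S x \<otimes> x = \<one>"
    using right_div_THE[OF x one_closed] by (simp_all add: left_inv_def)
  have i: "inv x = left_inv S x" "x \<otimes> left_inv S x = \<one>"
    using inv_eq_left_inv[OF bspec[OF f] x] by auto
  show ix: "inv x \<in> carrier S" "inv x \<otimes> x = \<one>" using l i by simp_all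
  show "inv (inv x) = x"
  proof -
    have "inv (inv x) = left_inv S (inv x)"
      using inv_eq_left_inv(1)[OF bspec[OF f] ix(1)] .
    also have "\<dots> = x"
      unfolding left_inv_def using ix(1) x i right_cancel
      by (intro the_equality) (simp, metis)
    finally show ?thesis .
  qed
  show "(z \<otimes> inv x) \<otimes> x = z" if z: "z \<in> carrier S"
  proof -
    have "right_inner S (inv x) x z \<otimes> (inv x \<otimes> x) = (z \<otimes> inv x) \<otimes> x"
      using right_div_THE(2)[of "inv x \<otimes> x" "(z \<otimes> inv x) \<otimes> x"] ix x z m_closed one_closed
      by (simp add: right_inner_def)
    then show ?thesis
      using bspec[OF f x] i ix z r_one by simp
  qed
qed

end

theorem proposition4p1:
  fixes S :: "('a, 'b) monoid_scheme" (structure) and y :: 'a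
  assumes "right_loop S"
    and "\<forall>u\<in>carrier S - {\<one>}. \<forall>v\<in>carrier S - {\<one>}.
           \<exists>h\<in>carrier (inner_mapping_group S). h u = v"
    and "y \<in> carrier S - {\<one>}"
    and "sigma S y \<in> hom (inner_mapping_group S) (inner_mapping_group S)"
  shows "(\<forall>x\<in>carrier S - {\<one>}. sigma S x = sigma S y) \<and>
         ((\<forall>x\<in>carrier S. right_inner S (left_inv S x) x = (\<lambda>z\<in>carrier S. z)) \<longrightarrow>
            involutory_auto (inner_mapping_group S) (sigma S y) \<and>
            carrier (inner_mapping_group S) \<subseteq> TAut S)"
proof -
  interpret right_loop S by fact
  let ?G = "inner_mapping_group S"
  let ?\<sigma> = "sigma S y"
  have y: "y \<in> carrier S" "y \<noteq> \<one>" using assms(3) by auto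
  have \<sigma>_closed: "?\<sigma> h \<in> carrier ?G" if "h \<in> carrier ?G" for h
    using assms(4) that by (auto simp: hom_def)
  have same: "sigma S x = ?\<sigma>" if "x \<in> carrier S - {\<one>}" for x
    using assms(2,3) that sigma_eq_on_orbit[OF assms(4) y(1)] by metis
  have \<sigma>_eq: "?\<sigma> h x \<otimes> h u = h (x \<otimes> u)"
    if "h \<in> carrier ?G" "x \<in> carrier S" "u \<in> carrier S - {\<one>}" for h x u
    using sigma_closed_and_eq(2)[of h x u] same that by simp
  have "involutory_auto ?G ?\<sigma> \<and> carrier ?G \<subseteq> TAut S"
    if f: "\<forall>x\<in>carrier S. right_inner S (left_inv S x) x = (\<lambda>z\<in>carrier S. z)"
  proof
    note inv = right_inner_id_imp_cancel[OF f]
    have inv_one: "inv \<one> = \<one>"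
      using inv(1,2)[OF one_closed] r_one by simp
    have inv_neq: "inv u \<in> carrier S - {\<one>}" if "u \<in> carrier S - {\<one>}" for u
      using inv(1,3)[of u] inv_one that by auto
    have \<sigma>_inv: "?\<sigma> h (inv u) = inv (h u)"
      if h: "h \<in> carrier ?G" and u: "u \<in> carrier S - {\<one>}" for h u
    proof -
      have u': "u \<in> carrier S" and hu: "h u \<in> carrier S"
        using u h inner_mapping_closed by auto
      have "?\<sigma> h (inv u) \<otimes> h u = inv (h u) \<otimes> h u"
        using \<sigma>_eq[OF h _ u, of "inv u"] inv(1,2) u' hu inner_mapping_group_memD(2)[OF h] by simp
      then show ?thesis
        using sigma_closed_and_eq(1)[OF h _ y(1)] inv(1) u' hu right_cancel by blast
    qed
    have \<sigma>_conj: "?\<sigma> h x = inv (h (inv x))" if h: "h \<in> carrier ?G" and x: "x \<in> carrier S" for h x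
    proof (cases "x = \<one>")
      case True
      \<comment> \<open>The identity for \<open>\<sigma>\<close> needs \<open>u \<noteq> e\<close>, so \<open>x = e\<close> cannot be written as \<open>u'\<close> here.\<close>
      have "?\<sigma> h \<one> = \<one>"
        using inner_mapping_group_memD(2)[OF \<sigma>_closed[OF h]] .
      then show ?thesis
        using True inner_mapping_group_memD(2)[OF h] inv_one by simp
    next
      case False
      then show ?thesis using \<sigma>_inv[OF h inv_neq, of x] inv(3) x by simp
    qed
    have invol: "?\<sigma> (?\<sigma> h) = h" if h: "h \<in> carrier ?G" for h
    proof (rule extensionalityI[where A = "carrier S"])
      fix x assume x: "x \<in> carrier S"
      have hy: "h y \<in> carrier S" and iy: "inv y \<in> carrier S - {\<one>}"
        using h y inner_mapping_closed inv_neq by auto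
      have xx: "?\<sigma> (?\<sigma> h) x \<in> carrier S"
        using sigma_closed_and_eq(1)[OF \<sigma>_closed[OF h] x y(1)] .
      have "h x = h ((x \<otimes> inv y) \<otimes> y)"
        using inv(4)[of y x] x y by simp
      also have "\<dots> = ?\<sigma> h (x \<otimes> inv y) \<otimes> h y"
        using \<sigma>_eq[OF h _ assms(3), of "x \<otimes> inv y"] x iy m_closed by simp
      also have "?\<sigma> h (x \<otimes> inv y) = ?\<sigma> (?\<sigma> h) x \<otimes> inv (h y)"
        using \<sigma>_eq[OF \<sigma>_closed[OF h] x iy] \<sigma>_inv[OF h assms(3)] by simp
      also have "(?\<sigma> (?\<sigma> h) x \<otimes> inv (h y)) \<otimes> h y = ?\<sigma> (?\<sigma> h) x"
        using inv(4)[OF hy xx] by simp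
      finally show "?\<sigma> (?\<sigma> h) x = h x" by simp
    qed (rule Bij_imp_extensional inner_mapping_group_memD(1) \<sigma>_closed h)+
    have "bij_betw ?\<sigma> (carrier ?G) (carrier ?G)"
      by (rule bij_betw_byWitness[where f' = ?\<sigma>]) (use invol \<sigma>_closed in auto)
    then show "involutory_auto ?G ?\<sigma>"
      using assms(4) invol
      by (auto simp: involutory_auto_def auto_def Bij_def sigma_def[of S y] compose_def
          simp del: restrict_apply intro!: restrict_ext)
    show "carrier ?G \<subseteq> TAut S"
    proof
      fix h assume h: "h \<in> carrier ?G"
      have "h (x \<otimes> u) = inv (h (inv x)) \<otimes> h u"
        if "x \<in> carrier S" "u \<in> carrier S" "u \<noteq> \<one>" for x u
        using \<sigma>_eq[OF h, of x u] \<sigma>_conj[OF h, of x] that by simp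
      then show "h \<in> TAut S"
        using inner_mapping_group_memD(1)[OF h] by (simp add: TAut_def)
    qed
  qed
  then show ?thesis using same by blast
qed

end
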